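(* Let $p\ge1$ and $n\ge 2p$ be integers. For all $U,\widetilde U\in\mathrm{St}(n,p)$, if $\|\widetilde U-U\|_{\mathrm F}\le2$, then $$d_{\mathrm E}(U,\widetilde U)\le 2\arcsin\left(\frac{\|\widetilde U-U\|_{\mathrm F}}{2}\right).$$
   Context: The Stiefel manifold is $\mathrm{St}(n,p)=\{U\in\mathbb{R}^{n\times p} : U^TU=I_p\}$, and $\|\cdot\|_{\mathrm F}$ is the Frobenius norm. The Euclidean geodesic distance on $\mathrm{St}(n,p)$ (induced by the metric inherited from $\mathbb{R}^{n\times p}$ with the Frobenius inner product) is $d_{\mathrm E}(U,\widetilde U)=\inf_\gamma\int_0^1\|\dot\gamma(t)\|_{\mathrm F}\,dt$, the infimum being over continuously differentiable curves $\gamma:[0,1]\to\mathrm{St}(n,p)$ with $\gamma(0)=U$, $\gamma(1)=\widetilde U$. *)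

theory Defs
  imports "HOL-Analysis.Analysis"
begin

text \<open>
  An \<open>n \<times> p\<close> real matrix is an element of \<^typ>\<open>real^'p^'n\<close> (rows indexed by \<open>'n\<close>, columns by
  \<open>'p\<close>), with \<open>n = CARD('n)\<close> and \<open>p = CARD('p)\<close>. The library norm on this type is the Frobenius
  norm:
\<close>

lemma norm_eq_frobenius:
  fixes A :: "real^'p^'n"
  shows "norm A = sqrt (\<Sum>i\<in>UNIV. \<Sum>j\<in>UNIV. (A $ i $ j)\<^sup>2)"
  by (simp add: norm_vec_def L2_set_def sum_nonneg)

definition stiefel :: "(real^'p^'n) set" where
  "stiefel = {U. transpose U ** U = mat 1}"

text \<open>
  Derivatives at \<open>0\<close> and \<open>1\<close> are one-sided, so that nothing is required of \<open>\<gamma>\<close> outside \<open>[0,1]\<close>.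
\<close>

definition stiefel_curves :: "real^'p^'n \<Rightarrow> real^'p^'n \<Rightarrow> (real \<Rightarrow> real^'p^'n) set" where
  "stiefel_curves U V =
     {\<gamma>. (\<forall>t\<in>{0..1}. \<gamma> differentiable (at t within {0..1})) \<and>
         continuous_on {0..1} (\<lambda>t. vector_derivative \<gamma> (at t within {0..1})) \<and>
         \<gamma> ` {0..1} \<subseteq> stiefel \<and> \<gamma> 0 = U \<and> \<gamma> 1 = V}"

definition curve_length :: "(real \<Rightarrow> real^'p^'n) \<Rightarrow> real" where
  "curve_length \<gamma> = integral {0..1} (\<lambda>t. norm (vector_derivative \<gamma> (at t within {0..1})))"

text \<open>
  The infimum is taken in the extended reals, so the distance between points not joined by any
  admissible curve is \<open>\<infinity>\<close> (for type \<^typ>\<open>real\<close> the infimum of the empty set would be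
  a meaningless value).
\<close>

definition dist_E :: "real^'p^'n \<Rightarrow> real^'p^'n \<Rightarrow> ereal" where
  "dist_E U V = (INF \<gamma>\<in>stiefel_curves U V. ereal (curve_length \<gamma>))"

end

theory Submission
  imports Defs
begin

text \<open>
  The comparison curve is the polar factor of the segment from \<open>U\<close> to \<open>V\<close>. In an orthonormal basis
  diagonalizing \<open>(V - U)\<^sup>T (V - U)\<close>, the points of the segment have mutually orthogonal columns, so
  taking the polar factor amounts to normalizing each column. With \<open>e\<^sub>b = |(V - U) b|\<^sup>2 / 4\<close> and the
  parameter \<open>\<tau> \<in> [-1,1]\<close>, the squared half-chord between the points at \<open>-\<tau>\<close> and \<open>\<tau>\<close> is
  \<open>S = \<Sum>\<^sub>b s\<^sub>b\<close> with \<open>s\<^sub>b = \<tau>\<^sup>2 e\<^sub>b / (1 - (1 - \<tau>\<^sup>2) e\<^sub>b)\<close>. The squared speed is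
  \<open>\<Sum>\<^sub>b s\<^sub>b (1 - s\<^sub>b) / \<tau>\<^sup>2\<close>, and \<open>\<Sum>\<^sub>b s\<^sub>b\<^sup>2 \<le> S\<^sup>2\<close> says exactly that it is at most the squared
  derivative of \<open>arcsin (sqrt S)\<close>. The polar factor breaks down only if some \<open>e\<^sub>b = 1\<close>; then \<open>V\<close>
  and \<open>U\<close> differ by the sign of one column, which is rotated through a vector normal to the range
  of \<open>U\<close>.
\<close>

section \<open>Singular bases of a linear map\<close>

text \<open>A unit vector \<open>x\<close> of \<open>S\<close> maximizing \<open>norm (A x)\<close>
  is a top singular vector: by first-order optimality \<open>A x\<close> is orthogonal to
  \<open>A y\<close> for all \<open>y\<close> in \<open>S\<close> orthogonal to \<open>x\<close>.
  Split \<open>x\<close> off and recurse on its complement in \<open>S\<close>; hence the general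
  subspace.\<close>

lemma exists_basis_orthogonal_images:
  fixes A :: "'a::euclidean_space \<Rightarrow> 'b::real_inner"
  assumes A: "linear A" and S: "subspace S"
  shows "\<exists>B. finite B \<and> B \<subseteq> S \<and> span B = S \<and> (\<forall>b\<in>B. norm b = 1) \<and>
           (\<forall>b\<in>B. \<forall>c\<in>B. b \<noteq> c \<longrightarrow> b \<bullet> c = 0 \<and> A b \<bullet> A c = 0)"
  using S
proof (induction "dim S" arbitrary: S rule: less_induct)
  case (less S)
  interpret A: linear A by (fact A)
  show ?case
  proof (cases "S = {0}")
    case True
    then show ?thesis by (intro exI[of _ "{}"]) auto
  next
    case False
    let ?K = "S \<inter> sphere 0 1"
    have "compact ?K"
      using closed_subspace[OF less.prems] by (auto intro: closed_Int_compact)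
    moreover have "?K \<noteq> {}"
    proof -
      from False less.prems obtain v where "v \<in> S" "v \<noteq> 0"
        using subspace_0 by blast
      then have "v /\<^sub>R norm v \<in> ?K"
        using less.prems by (auto simp: subspace_scale)
      then show ?thesis by blast
    qed
    moreover have "continuous_on ?K (\<lambda>x. norm (A x))"
      using A linear_continuous_on linear_conv_bounded_linear continuous_on_norm by blast
    ultimately obtain x where x: "x \<in> ?K" and max: "\<And>y. y \<in> ?K \<Longrightarrow> norm (A y) \<le> norm (A x)"
      using continuous_attains_sup by (metis (no_types, lifting))
    have xS: "x \<in> S" and nx: "norm x = 1" using x by auto
    have bound: "norm (A z) \<le> norm (A x) * norm z" if "z \<in> S" for z
    proof (cases "z = 0")
      case False
      then have "z /\<^sub>R norm z \<in> ?K"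
        using that less.prems by (auto simp: subspace_scale)
      then have "norm (A (z /\<^sub>R norm z)) \<le> norm (A x)" by (rule max)
      then show ?thesis using False by (simp add: A.scale field_simps)
    qed (simp add: A.zero)
    have orth: "A x \<bullet> A y = 0" if y: "y \<in> S" and xy: "x \<bullet> y = 0" for y
    proof -
      define k where "k = A x \<bullet> A y"
      define M where "M = (norm (A x))\<^sup>2 * (norm y)\<^sup>2"
      have M0: "M \<ge> 0" by (simp add: M_def)
      \<comment> \<open>Moving the maximizer along \<open>y\<close> and applying
        \<open>bound\<close> leaves a linear term in \<open>s\<close> dominated by a quadratic one
        for every real \<open>s\<close>, which forces \<open>k = 0\<close>.\<close>
      have quad: "2 * s * k \<le> s\<^sup>2 * M" for s :: real
      proof -
        have "x + s *\<^sub>R y \<in> S"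
          using xS y less.prems by (simp add: subspace_add subspace_scale)
        from power_mono[OF bound[OF this], of 2]
        have "(norm (A (x + s *\<^sub>R y)))\<^sup>2 \<le> (norm (A x))\<^sup>2 * (norm (x + s *\<^sub>R y))\<^sup>2"
          by (simp add: power_mult_distrib)
        moreover have "(norm (x + s *\<^sub>R y))\<^sup>2 = 1 + s\<^sup>2 * (norm y)\<^sup>2"
          using nx xy
          by (simp add: power2_norm_eq_inner inner_add_left inner_add_right inner_commute
              norm_eq_1 power2_eq_square[of s])
        moreover have "(norm (A (x + s *\<^sub>R y)))\<^sup>2 = (norm (A x))\<^sup>2 + 2 * s * k + s\<^sup>2 * (norm (A y))\<^sup>2"
          by (simp add: power2_norm_eq_inner inner_add_left inner_add_right inner_commute
              A.add A.scale k_def power2_eq_square[of s])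
        ultimately have "2 * s * k + s\<^sup>2 * (norm (A y))\<^sup>2 \<le> s\<^sup>2 * M"
          by (simp add: M_def algebra_simps)
        moreover have "0 \<le> s\<^sup>2 * (norm (A y))\<^sup>2" by simp
        ultimately show ?thesis by linarith
      qed
      \<comment> \<open>With this \<open>s\<close>, \<open>quad\<close> reads
        \<open>2 * s^2 * (M + 1) \<le> s^2 * M\<close>, so \<open>s = 0\<close>; the added 1 keeps
        the denominator positive.\<close>
      define s where "s = k / (M + 1)"
      have k: "k = s * (M + 1)" using M0 by (simp add: s_def)
      have "s\<^sup>2 * (M + 2) \<le> 0"
        using quad[of s] by (simp add: k power2_eq_square algebra_simps)
      then have "k = 0" using M0 by (auto simp: k mult_le_0_iff)
      then show ?thesis by (simp add: k_def)
    qed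
    define T where "T = {y \<in> S. x \<bullet> y = 0}"
    have T: "subspace T"
      using less.prems by (auto simp: T_def subspace_def inner_add_right)
    have "x \<notin> T" "T \<subseteq> S" using nx by (auto simp: T_def norm_eq_1)
    then have "T \<subset> S" using xS by blast
    then have "dim T < dim S"
      using T less.prems by (metis dim_psubset span_eq_iff)
    from less.hyps[OF this T] obtain B where B: "finite B" "B \<subseteq> T" "span B = T"
      "\<forall>b\<in>B. norm b = 1" "\<forall>b\<in>B. \<forall>c\<in>B. b \<noteq> c \<longrightarrow> b \<bullet> c = 0 \<and> A b \<bullet> A c = 0"
      by blast
    have xB: "x \<bullet> b = 0 \<and> b \<bullet> x = 0 \<and> A x \<bullet> A b = 0 \<and> A b \<bullet> A x = 0" if "b \<in> B" for b
      using that B(2) orth by (auto simp: T_def inner_commute)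
    have "span (insert x B) = S"
    proof
      show "span (insert x B) \<subseteq> S"
        using B(2) xS less.prems by (intro span_minimal) (auto simp: T_def)
      show "S \<subseteq> span (insert x B)"
      proof
        fix y assume "y \<in> S"
        then have "y - (x \<bullet> y) *\<^sub>R x \<in> T"
          using xS less.prems nx
          by (simp add: T_def subspace_diff subspace_scale inner_diff_right norm_eq_1)
        then show "y \<in> span (insert x B)"
          using B(3) span_breakdown_eq by blast
      qed
    qed
    moreover have "insert x B \<subseteq> S" using xS B(2) by (auto simp: T_def)
    ultimately show ?thesis
      using B nx xB by (intro exI[of _ "insert x B"]) auto
  qed
qed

section \<open>Orthonormal bases and rank-one expansions\<close>

definition orthonormal_basis :: "'a::euclidean_space set \<Rightarrow> bool" where
  "orthonormal_basis B \<longleftrightarrow>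
     finite B \<and> span B = UNIV \<and> (\<forall>b\<in>B. \<forall>c\<in>B. b \<bullet> c = (if b = c then 1 else 0))"

lemma orthonormal_basis_sum:
  assumes "orthonormal_basis B"
  shows "(\<Sum>b\<in>B. (b \<bullet> x) *\<^sub>R b) = x"
proof -
  have fin: "finite B" and on: "\<And>b c. b \<in> B \<Longrightarrow> c \<in> B \<Longrightarrow> b \<bullet> c = (if b = c then 1 else 0)"
    using assms by (auto simp: orthonormal_basis_def)
  obtain u where u: "x = (\<Sum>b\<in>B. u b *\<^sub>R b)"
    using assms span_finite[OF fin] UNIV_I[of x] unfolding orthonormal_basis_def by blast
  have "b \<bullet> x = u b" if "b \<in> B" for b
    using that fin by (simp add: u inner_sum_right on if_distrib cong: if_cong)
  then show ?thesis by (simp add: u cong: sum.cong)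
qed

definition outer :: "real^'n \<Rightarrow> real^'p \<Rightarrow> real^'p^'n" where
  "outer u v = (\<chi> i j. u $ i * v $ j)"

lemma outer_mult_vec: "outer u v *v x = (v \<bullet> x) *\<^sub>R u"
  by (simp add: outer_def vec_eq_iff matrix_vector_mult_def inner_vec_def sum_distrib_left
      mult_ac)

lemma inner_outer: "A \<bullet> outer u v = (A *v v) \<bullet> u"
  by (simp add: outer_def matrix_vector_mult_def inner_vec_def sum_distrib_left mult_ac)

lemma bounded_linear_outer: "bounded_linear (\<lambda>u. outer u v)"
  by (simp add: linear_conv_bounded_linear[symmetric] outer_def linear_iff vec_eq_iff
      algebra_simps)

lemma sum_matrix_vector_mult: "(\<Sum>b\<in>B. F b) *v x = (\<Sum>b\<in>B. F b *v (x :: real^'p))"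
  by (induction B rule: infinite_finite_induct) (auto simp: matrix_vector_mult_add_rdistrib)

context
  fixes B :: "(real^'p) set"
  assumes B: "orthonormal_basis B"
begin

lemma sum_outer_mult_basis:
  assumes "c \<in> B"
  shows "(\<Sum>b\<in>B. outer (g b) b) *v c = g c"
proof -
  have "b \<bullet> c = (if b = c then 1 else 0)" if "b \<in> B" for b
    using B assms that by (simp add: orthonormal_basis_def)
  then have "(\<Sum>b\<in>B. outer (g b) b) *v c = (\<Sum>b\<in>B. if b = c then g b else 0)"
    by (auto simp: sum_matrix_vector_mult outer_mult_vec intro!: sum.cong)
  then show ?thesis using B assms by (simp add: orthonormal_basis_def)
qed

text \<open>This is \<open>A\<close> applied to the resolution of the identity by the rank-one
  projections onto the basis vectors. It lets matrices be assembled from their values on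
  \<open>B\<close>.\<close>

lemma sum_outer_columns: "(\<Sum>b\<in>B. outer (A *v b) b) = (A :: real^'p^'n)"
proof -
  have "(\<Sum>b\<in>B. outer (A *v b) b) *v x = A *v x" for x
  proof -
    have "(\<Sum>b\<in>B. outer (A *v b) b) *v x = A *v (\<Sum>b\<in>B. (b \<bullet> x) *\<^sub>R b)"
      by (simp add: sum_matrix_vector_mult outer_mult_vec linear_sum[OF matrix_vector_mul_linear]
          matrix_vector_mult_scaleR)
    then show ?thesis by (simp add: orthonormal_basis_sum[OF B])
  qed
  then show ?thesis by (simp add: matrix_eq)
qed

text \<open>The Frobenius norm does not depend on the orthonormal basis of the domain: pair
  \<open>A\<close> with its own expansion.\<close>

lemma norm_matrix_basis: "(norm (A :: real^'p^'n))\<^sup>2 = (\<Sum>b\<in>B. (norm (A *v b))\<^sup>2)"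
proof -
  have "(norm A)\<^sup>2 = A \<bullet> (\<Sum>b\<in>B. outer (A *v b) b)"
    by (simp add: sum_outer_columns power2_norm_eq_inner)
  also have "\<dots> = (\<Sum>b\<in>B. (norm (A *v b))\<^sup>2)"
    by (simp add: inner_sum_right inner_outer power2_norm_eq_inner)
  finally show ?thesis .
qed

lemma norm_sum_outer: "norm (\<Sum>b\<in>B. outer (g b) b) = sqrt (\<Sum>b\<in>B. (norm (g b))\<^sup>2)"
  using norm_matrix_basis[of "\<Sum>b\<in>B. outer (g b) b"]
  by (simp add: sum_outer_mult_basis real_sqrt_unique cong: sum.cong)

end

section \<open>Stiefel matrices and curves, column by column\<close>

lemma stiefel_iff_inner:
  "(U :: real^'p^'n) \<in> stiefel \<longleftrightarrow> (\<forall>x y. (U *v x) \<bullet> (U *v y) = x \<bullet> y)"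
proof -
  have "(U *v x) \<bullet> (U *v y) = ((transpose U ** U) *v x) \<bullet> y" for x y
    by (metis dot_lmul_matrix matrix_vector_mul_assoc vector_transpose_matrix
        transpose_transpose inner_commute)
  then show ?thesis
    by (auto simp: stiefel_def matrix_eq vector_eq_rdot)
qed

text \<open>Both Gram forms are bilinear, so agreement on pairs from a spanning set
  suffices.\<close>

lemma stiefel_basisI:
  assumes B: "orthonormal_basis (B :: (real^'p) set)"
    and "\<And>b c. b \<in> B \<Longrightarrow> c \<in> B \<Longrightarrow> ((U :: real^'p^'n) *v b) \<bullet> (U *v c) = b \<bullet> c"
  shows "U \<in> stiefel"
proof -
  have lin: "bilinear (\<lambda>x y. (U *v x) \<bullet> (U *v y))" "bilinear (\<lambda>x y. x \<bullet> (y :: real^'p))"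
    by (auto simp: bilinear_def linear_iff inner_add_left inner_add_right
        matrix_vector_right_distrib matrix_vector_mult_scaleR)
  have "(U *v x) \<bullet> (U *v y) = x \<bullet> y" for x y
    using bilinear_eq[OF lin, of UNIV B UNIV B x y] B assms(2) by (simp add: orthonormal_basis_def)
  then show ?thesis by (simp add: stiefel_iff_inner)
qed

text \<open>Reduces the problem to choosing one vector curve per basis element: their rank-one sum
  is an admissible matrix curve, and its Frobenius speed is the l2 sum of the column speeds.\<close>

lemma dist_E_le_columnwise:
  fixes U V :: "real^'p^'n" and g g' :: "real^'p \<Rightarrow> real \<Rightarrow> real^'n"
  assumes B: "orthonormal_basis B"
    and deriv: "\<And>b t. b \<in> B \<Longrightarrow> t \<in> {0..1} \<Longrightarrow>
                  (g b has_vector_derivative g' b t) (at t within {0..1})"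
    and cont: "\<And>b. b \<in> B \<Longrightarrow> continuous_on {0..1} (g' b)"
    and orth: "\<And>b c t. b \<in> B \<Longrightarrow> c \<in> B \<Longrightarrow> t \<in> {0..1} \<Longrightarrow> g b t \<bullet> g c t = b \<bullet> c"
    and ends: "\<And>b. b \<in> B \<Longrightarrow> g b 0 = U *v b" "\<And>b. b \<in> B \<Longrightarrow> g b 1 = V *v b"
  shows "dist_E U V \<le> ereal (integral {0..1} (\<lambda>t. sqrt (\<Sum>b\<in>B. (norm (g' b t))\<^sup>2)))"
proof -
  define \<gamma> where "\<gamma> t = (\<Sum>b\<in>B. outer (g b t) b)" for t
  define \<gamma>' where "\<gamma>' t = (\<Sum>b\<in>B. outer (g' b t) b)" for t
  have d: "(\<gamma> has_vector_derivative \<gamma>' t) (at t within {0..1})" if "t \<in> {0..1}" for t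
    unfolding \<gamma>_def \<gamma>'_def
    by (intro has_vector_derivative_sum bounded_linear.has_vector_derivative[OF bounded_linear_outer]
        deriv that)
  have diff: "\<gamma> differentiable (at t within {0..1})" if "t \<in> {0..1}" for t
    using d[OF that] unfolding has_vector_derivative_def differentiable_def by blast
  have vd: "vector_derivative \<gamma> (at t within {0..1}) = \<gamma>' t" if "t \<in> {0..1}" for t
    using d[OF that] that by (simp add: vector_derivative_within_closed_interval)
  have "continuous_on {0..1} \<gamma>'"
    unfolding \<gamma>'_def
    by (intro continuous_on_sum bounded_linear.continuous_on[OF bounded_linear_outer] cont)
  then have "continuous_on {0..1} (\<lambda>t. vector_derivative \<gamma> (at t within {0..1}))"
    by (rule continuous_on_eq) (simp add: vd)
  moreover have "\<gamma> t \<in> stiefel" if "t \<in> {0..1}" for t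
  proof (rule stiefel_basisI[OF B])
    fix b c assume "b \<in> B" "c \<in> B"
    then show "(\<gamma> t *v b) \<bullet> (\<gamma> t *v c) = b \<bullet> c"
      unfolding \<gamma>_def by (simp only: sum_outer_mult_basis[OF B] orth[OF _ _ that])
  qed
  moreover have "\<gamma> 0 = U" "\<gamma> 1 = V"
    using sum_outer_columns[OF B] by (simp_all add: \<gamma>_def ends cong: sum.cong)
  ultimately have "\<gamma> \<in> stiefel_curves U V"
    using diff by (auto simp: stiefel_curves_def)
  then have "dist_E U V \<le> ereal (curve_length \<gamma>)"
    unfolding dist_E_def by (rule INF_lower)
  also have "curve_length \<gamma> = integral {0..1} (\<lambda>t. sqrt (\<Sum>b\<in>B. (norm (g' b t))\<^sup>2))"
    unfolding curve_length_def
    by (intro integral_cong) (simp add: vd \<gamma>'_def norm_sum_outer[OF B])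
  finally show ?thesis .
qed

section \<open>Length of the normalized segment\<close>

text \<open>In the application \<open>C\<close> and \<open>D\<close> are orthogonal with squared
  norms \<open>1 - e\<close> and \<open>e\<close>, so the square root is the norm of
  \<open>C + \<tau> *\<^sub>R D\<close> and the curve lies on the unit sphere.\<close>

lemma has_vector_derivative_normalized_segment:
  fixes C D :: "'a::real_normed_vector"
  assumes pos: "1 - (1 - \<tau>\<^sup>2) * e > 0"
  shows "((\<lambda>\<tau>. (1 / sqrt (1 - (1 - \<tau>\<^sup>2) * e)) *\<^sub>R (C + \<tau> *\<^sub>R D)) has_vector_derivative
          (1 / sqrt (1 - (1 - \<tau>\<^sup>2) * e) ^ 3) *\<^sub>R ((1 - e) *\<^sub>R D - (\<tau> * e) *\<^sub>R C)) (at \<tau>)"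
proof -
  define N where "N = sqrt (1 - (1 - \<tau>\<^sup>2) * e)"
  have N: "N > 0" "N\<^sup>2 = 1 - (1 - \<tau>\<^sup>2) * e" using pos by (simp_all add: N_def)
  have "((\<lambda>\<tau>. 1 - (1 - \<tau>\<^sup>2) * e) has_real_derivative 2 * \<tau> * e) (at \<tau>)"
    by (auto intro!: derivative_eq_intros)
  then have "((\<lambda>\<tau>. sqrt (1 - (1 - \<tau>\<^sup>2) * e)) has_real_derivative inverse N / 2 * (2 * \<tau> * e)) (at \<tau>)"
    unfolding N_def by (intro DERIV_chain2[where f = sqrt] DERIV_real_sqrt pos)
  then have dN: "((\<lambda>\<tau>. 1 / sqrt (1 - (1 - \<tau>\<^sup>2) * e)) has_real_derivative - (\<tau> * e) / N ^ 3) (at \<tau>)"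
    using N(1) by (intro DERIV_cong[OF DERIV_divide[OF DERIV_const]])
      (auto simp only: N_def[symmetric], auto simp: field_simps power3_eq_cube)
  have dL: "((\<lambda>\<tau>. C + \<tau> *\<^sub>R D) has_vector_derivative D) (at \<tau>)"
    by (auto intro!: derivative_eq_intros)
  \<comment> \<open>Product rule over the common denominator \<open>N ^ 3\<close>; the coefficient
    of \<open>D\<close> then collapses to \<open>1 - e\<close>.\<close>
  have "(1 / N) *\<^sub>R D + (- (\<tau> * e) / N ^ 3) *\<^sub>R (C + \<tau> *\<^sub>R D)
      = (1 / N ^ 3) *\<^sub>R ((N\<^sup>2 - \<tau>\<^sup>2 * e) *\<^sub>R D - (\<tau> * e) *\<^sub>R C)"
    using N(1)
    by (simp add: algebra_simps power2_eq_square power3_eq_cube)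
  also have "N\<^sup>2 - \<tau>\<^sup>2 * e = 1 - e" by (simp add: N(2) algebra_simps)
  finally show ?thesis
    using has_vector_derivative_scaleR[OF dN dL] by (simp add: N_def[symmetric])
qed


text \<open>Each \<open>x b\<close> is at most the whole sum. This is the only source of loss in the
  length estimate; a single nonzero term gives equality.\<close>

lemma sum_power2_le:
  fixes x :: "'b \<Rightarrow> real"
  assumes "finite B" "\<And>b. b \<in> B \<Longrightarrow> 0 \<le> x b"
  shows "(\<Sum>b\<in>B. (x b)\<^sup>2) \<le> (sum x B)\<^sup>2"
proof -
  have "(\<Sum>b\<in>B. (x b)\<^sup>2) \<le> (\<Sum>b\<in>B. x b * sum x B)"
    unfolding power2_eq_square using assms by (intro sum_mono mult_left_mono member_le_sum) auto
  then show ?thesis by (simp add: power2_eq_square sum_distrib_right)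
qed

text \<open>The integrand is bounded by the derivative of
  \<open>arcsin (\<sigma> (2 * t - 1))\<close>, where \<open>\<sigma>\<close> is odd with square
  \<open>S\<close>; the factor 2 in the integrand comes from
  \<open>\<tau> = 2 * t - 1\<close>.\<close>

lemma integral_speed_le_arcsin:
  fixes e :: "'b \<Rightarrow> real"
  assumes fin: "finite B" and e: "\<And>b. b \<in> B \<Longrightarrow> 0 \<le> e b \<and> e b < 1" and le1: "sum e B \<le> 1"
  shows "integral {0..1}
           (\<lambda>t. 2 * sqrt (\<Sum>b\<in>B. e b * (1 - e b) / (1 - (1 - (2 * t - 1)\<^sup>2) * e b)\<^sup>2))
         \<le> 2 * arcsin (sqrt (sum e B))"
\<comment> \<open>If all \<open>e b\<close> vanish, so does \<open>Q\<close>, and dividing by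
  \<open>sqrt (Q \<tau>)\<close> below would be meaningless; both sides are then 0.\<close>
proof (cases "sum e B = 0")
  case True
  then have "e b = 0" if "b \<in> B" for b
    using that e sum_nonneg_eq_0_iff[OF fin] by blast
  then show ?thesis by simp
next
  case False
  then obtain b0 where b0: "b0 \<in> B" "e b0 > 0"
    by (metis e less_eq_real_def sum.neutral)
  define P where "P \<tau> b = 1 - (1 - \<tau>\<^sup>2) * e b" for \<tau> b
  define A where "A \<tau> = (\<Sum>b\<in>B. e b * (1 - e b) / (P \<tau> b)\<^sup>2)" for \<tau>
  define Q where "Q \<tau> = (\<Sum>b\<in>B. e b / P \<tau> b)" for \<tau>
  have P: "P \<tau> b > 0" if "b \<in> B" for \<tau> b
  proof -
    have "P \<tau> b = (1 - e b) + \<tau>\<^sup>2 * e b" by (simp add: P_def algebra_simps)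
    moreover have "\<tau>\<^sup>2 * e b \<ge> 0" using e[OF that] by simp
    ultimately show ?thesis using e[OF that] by linarith
  qed
  have Q: "Q \<tau> > 0" for \<tau>
    unfolding Q_def using b0 e P by (intro sum_pos2[OF fin b0(1)]) (auto simp: less_imp_le)
  have A0: "A \<tau> \<ge> 0" for \<tau>
    unfolding A_def using e by (intro sum_nonneg) (simp add: less_imp_le)
  \<comment> \<open>Termwise \<open>s\<^sub>b (1 - s\<^sub>b) / \<tau>\<^sup>2\<close> with
    \<open>s\<^sub>b = \<tau>\<^sup>2 e\<^sub>b / P\<close>, multiplied out so that it makes sense
    at \<open>\<tau> = 0\<close>.\<close>
  have AQ: "A \<tau> = Q \<tau> - \<tau>\<^sup>2 * (\<Sum>b\<in>B. (e b / P \<tau> b)\<^sup>2)" for \<tau>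
  proof -
    have "e b * (1 - e b) / (P \<tau> b)\<^sup>2 = e b / P \<tau> b - \<tau>\<^sup>2 * (e b / P \<tau> b)\<^sup>2" if "b \<in> B" for b
    proof -
      have "1 - e b = P \<tau> b - \<tau>\<^sup>2 * e b" by (simp add: P_def algebra_simps)
      then show ?thesis
        using P[OF that, of \<tau>] by (simp only:) (simp add: power2_eq_square field_simps)
    qed
    then show ?thesis by (simp add: A_def Q_def sum_subtractf sum_distrib_left)
  qed
  have A_ge: "Q \<tau> * (1 - \<tau>\<^sup>2 * Q \<tau>) \<le> A \<tau>" for \<tau>
  proof -
    have "(\<Sum>b\<in>B. (e b / P \<tau> b)\<^sup>2) \<le> (Q \<tau>)\<^sup>2"
      unfolding Q_def using e P by (intro sum_power2_le fin) (simp add: less_imp_le)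
    then have "\<tau>\<^sup>2 * (\<Sum>b\<in>B. (e b / P \<tau> b)\<^sup>2) \<le> \<tau>\<^sup>2 * (Q \<tau>)\<^sup>2"
      by (intro mult_left_mono) auto
    then show ?thesis by (simp add: AQ algebra_simps power2_eq_square)
  qed
  have Q_scaled: "\<tau>\<^sup>2 * Q \<tau> = (\<Sum>b\<in>B. \<tau>\<^sup>2 * (e b / P \<tau> b))" for \<tau>
    by (simp add: Q_def sum_distrib_left)
  \<comment> \<open>Uses \<open>P \<tau> b - \<tau>\<^sup>2 = (1 - e b) * (1 -
    \<tau>\<^sup>2)\<close>. The \<open>b0\<close> term makes \<open>S\<close> strictly smaller than
    \<open>sum e B\<close> inside the interval, so \<open>arcsin\<close> is differentiable there
    even if \<open>sum e B = 1\<close>.\<close>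
  have term_diff: "e b - \<tau>\<^sup>2 * (e b / P \<tau> b) = e b * (1 - e b) * (1 - \<tau>\<^sup>2) / P \<tau> b"
    if "b \<in> B" for b \<tau>
    using P[OF that, of \<tau>] by (simp add: field_simps) (simp add: P_def algebra_simps)
  have term_le: "\<tau>\<^sup>2 * (e b / P \<tau> b) \<le> e b" if "b \<in> B" "\<tau>\<^sup>2 \<le> 1" for b \<tau>
  proof -
    have "0 \<le> e b * (1 - e b) * (1 - \<tau>\<^sup>2) / P \<tau> b"
      using e[OF that(1)] that(2) P[OF that(1), of \<tau>] by simp
    then show ?thesis using term_diff[OF that(1), of \<tau>] by linarith
  qed
  have Qle: "\<tau>\<^sup>2 * Q \<tau> \<le> 1" if "\<tau>\<^sup>2 \<le> 1" for \<tau>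
  proof -
    have "\<tau>\<^sup>2 * Q \<tau> \<le> sum e B"
      unfolding Q_scaled by (intro sum_mono term_le that)
    then show ?thesis using le1 by simp
  qed
  have Qlt: "\<tau>\<^sup>2 * Q \<tau> < 1" if "\<tau>\<^sup>2 < 1" for \<tau>
  proof -
    have "0 < e b0 * (1 - e b0) * (1 - \<tau>\<^sup>2) / P \<tau> b0"
      using e[OF b0(1)] b0 that P[OF b0(1), of \<tau>] by simp
    then have "\<tau>\<^sup>2 * (e b0 / P \<tau> b0) < e b0" using term_diff[OF b0(1), of \<tau>] by linarith
    then have "\<tau>\<^sup>2 * Q \<tau> < sum e B"
      unfolding Q_scaled using that b0(1) term_le by (intro sum_strict_mono_ex1[OF fin]) auto
    then show ?thesis using le1 by simp
  qed
  \<comment> \<open>The square root of \<open>S\<close> with the sign of \<open>\<tau>\<close>: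
    smooth at 0, where \<open>sqrt S\<close> has a corner.\<close>
  define \<sigma> where "\<sigma> \<tau> = \<tau> * sqrt (Q \<tau>)" for \<tau>
  have sigma2: "(\<sigma> \<tau>)\<^sup>2 = \<tau>\<^sup>2 * Q \<tau>" for \<tau>
    using Q[of \<tau>] by (simp add: \<sigma>_def power_mult_distrib)
  \<comment> \<open>The product rule gives \<open>sqrt Q + \<tau> * Q' / (2 * sqrt Q)\<close>, and
    \<open>AQ\<close> identifies the numerator over \<open>sqrt Q\<close> as
    \<open>A\<close>.\<close>
  have dsigma: "(\<sigma> has_real_derivative A \<tau> / sqrt (Q \<tau>)) (at \<tau>)" for \<tau>
  proof -
    have "(Q has_real_derivative (\<Sum>b\<in>B. - (2 * \<tau>) * (e b / P \<tau> b)\<^sup>2)) (at \<tau>)"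
      unfolding Q_def P_def
    proof (rule DERIV_sum)
      fix b assume b: "b \<in> B"
      show "((\<lambda>\<tau>. e b / (1 - (1 - \<tau>\<^sup>2) * e b)) has_real_derivative
             - (2 * \<tau>) * (e b / (1 - (1 - \<tau>\<^sup>2) * e b))\<^sup>2) (at \<tau>)"
        using P[OF b, of \<tau>] unfolding P_def
        by (auto intro!: derivative_eq_intros simp: power2_eq_square)
    qed
    then have dQ: "(Q has_real_derivative - (2 * \<tau>) * (\<Sum>b\<in>B. (e b / P \<tau> b)\<^sup>2)) (at \<tau>)"
      by (simp only: sum_distrib_left)
    have "((\<lambda>\<tau>. sqrt (Q \<tau>)) has_real_derivative
        inverse (sqrt (Q \<tau>)) / 2 * (- (2 * \<tau>) * (\<Sum>b\<in>B. (e b / P \<tau> b)\<^sup>2))) (at \<tau>)"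
      by (intro DERIV_chain2[where f = sqrt] DERIV_real_sqrt Q dQ)
    from DERIV_mult[OF DERIV_ident this]
    show ?thesis
      unfolding \<sigma>_def
      by (rule DERIV_cong) (use Q[of \<tau>] in \<open>simp add: AQ field_simps power2_eq_square\<close>)
  qed
  define G where "G t = arcsin (\<sigma> (2 * t - 1))" for t
  define G' where "G' \<tau> = 2 * (A \<tau> / sqrt (Q \<tau>) / sqrt (1 - \<tau>\<^sup>2 * Q \<tau>))" for \<tau>
  define f where "f t = 2 * sqrt (A (2 * t - 1))" for t
  have sq: "(2 * t - 1)\<^sup>2 < 1" if "t \<in> {0<..<1}" for t :: real
    using that by (auto simp: abs_square_less_1)
  have sq_le: "(2 * t - 1)\<^sup>2 \<le> 1" if "t \<in> {0..1}" for t :: real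
    using that by (auto simp: abs_square_le_1)
  have P_nz: "P \<tau> b \<noteq> 0" if "b \<in> B" for \<tau> b
    using P[OF that, of \<tau>] by simp
  have contA: "continuous_on UNIV A"
    unfolding A_def P_def
    by (intro continuous_intros ballI) (use P_nz in \<open>simp add: P_def\<close>)
  have "continuous_on {0..1} f"
    unfolding f_def by (intro continuous_intros continuous_on_compose2[OF contA]) auto
  then have int_f: "f integrable_on {0..1}"
    by (rule integrable_continuous_real)
  have dG: "(G has_real_derivative G' (2 * t - 1)) (at t)" if t: "t \<in> {0<..<1}" for t
  proof -
    let ?\<tau> = "2 * t - 1"
    have "(\<sigma> ?\<tau>)\<^sup>2 < 1" using Qlt[OF sq[OF t]] by (simp add: sigma2)
    then have "\<bar>\<sigma> ?\<tau>\<bar> < 1" by (simp add: abs_square_less_1)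
    then have "(arcsin has_real_derivative inverse (sqrt (1 - (\<sigma> ?\<tau>)\<^sup>2))) (at (\<sigma> ?\<tau>))"
      by (intro DERIV_arcsin) auto
    moreover have "((\<lambda>t. \<sigma> (2 * t - 1)) has_real_derivative A ?\<tau> / sqrt (Q ?\<tau>) * 2) (at t)"
      by (rule DERIV_chain2[OF dsigma]) (auto intro!: derivative_eq_intros)
    ultimately have "(G has_real_derivative
        inverse (sqrt (1 - (\<sigma> ?\<tau>)\<^sup>2)) * (A ?\<tau> / sqrt (Q ?\<tau>) * 2)) (at t)"
      unfolding G_def by (rule DERIV_chain2)
    then show ?thesis by (simp add: G'_def sigma2 divide_inverse mult_ac)
  qed
  have f_le: "f t \<le> G' (2 * t - 1)" if t: "t \<in> {0<..<1}" for t
  proof -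
    let ?\<tau> = "2 * t - 1"
    \<comment> \<open>\<open>G'\<close> is \<open>2 * A / sqrt Y\<close>, so
      \<open>Y \<le> A\<close> gives \<open>sqrt A \<le> A / sqrt Y\<close>.\<close>
    define Y where "Y = Q ?\<tau> * (1 - ?\<tau>\<^sup>2 * Q ?\<tau>)"
    have Y: "Y > 0" "Y \<le> A ?\<tau>"
      using Q[of ?\<tau>] Qlt[OF sq[OF t]] A_ge[of ?\<tau>] by (simp_all add: Y_def)
    have "sqrt (A ?\<tau>) * sqrt Y \<le> sqrt (A ?\<tau>) * sqrt (A ?\<tau>)"
      using Y A0[of ?\<tau>] by (intro mult_left_mono) auto
    then have "sqrt (A ?\<tau>) * sqrt Y \<le> A ?\<tau>" using A0[of ?\<tau>] by simp
    then have "sqrt (A ?\<tau>) \<le> A ?\<tau> / sqrt Y" using Y by (simp add: field_simps)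
    then show ?thesis by (simp add: f_def G'_def Y_def real_sqrt_mult)
  qed
  have "continuous_on {0..1} G"
    unfolding G_def
  proof (rule continuous_on_arcsin)
    show "continuous_on {0..1} (\<lambda>t. \<sigma> (2 * t - 1))"
      by (rule continuous_on_compose2[of UNIV \<sigma>])
        (auto intro!: continuous_intros continuous_at_imp_continuous_on DERIV_isCont[OF dsigma])
    show "\<forall>t\<in>{0..1}. - 1 \<le> \<sigma> (2 * t - 1) \<and> \<sigma> (2 * t - 1) \<le> 1"
    proof
      fix t :: real assume "t \<in> {0..1}"
      from Qle[OF sq_le[OF this]] have "\<bar>\<sigma> (2 * t - 1)\<bar> \<le> 1"
        by (simp add: sigma2[symmetric] abs_square_le_1)
      then show "- 1 \<le> \<sigma> (2 * t - 1) \<and> \<sigma> (2 * t - 1) \<le> 1" by linarith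
    qed
  qed
  \<comment> \<open>\<open>G\<close> need not be differentiable at \<open>0\<close> and \<open>1\<close>, where \<open>\<sigma>\<close> may reach \<open>\<plusminus>1\<close>.\<close>
  then have "((\<lambda>t. if t \<in> {0<..<1} then G' (2 * t - 1) else f t) has_integral G 1 - G 0) {0..1}"
    using dG by (intro fundamental_theorem_of_calculus_interior)
      (auto simp: has_real_derivative_iff_has_vector_derivative)
  \<comment> \<open>At the endpoints the patched integrand equals \<open>f\<close>, so the
    comparison holds on all of \<open>{0..1}\<close>.\<close>
  then have "integral {0..1} f \<le> G 1 - G 0"
    using f_le by (intro has_integral_le[OF integrable_integral[OF int_f]]) auto
  also have "G 1 - G 0 = 2 * arcsin (sqrt (sum e B))"
  proof -
    have "P 1 b = 1" "P (- 1) b = 1" for b by (simp_all add: P_def)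
    then have "G 1 = arcsin (sqrt (sum e B))" "G 0 = arcsin (- sqrt (sum e B))"
      by (simp_all add: G_def \<sigma>_def Q_def)
    moreover have "sqrt (sum e B) \<le> 1" "0 \<le> sum e B"
      using le1 e by (auto intro: sum_nonneg)
    ultimately show ?thesis by (simp add: arcsin_minus order_trans[of "-1" 0])
  qed
  finally show ?thesis unfolding f_def A_def P_def .
qed

section \<open>The comparison curves from \<open>U\<close> to \<open>V\<close>\<close>

theorem theorem6p5:
  fixes U V :: "real^'p^'n"
  assumes "CARD('n) \<ge> 2 * CARD('p)"
    and "U \<in> stiefel" and "V \<in> stiefel"
    and "norm (V - U) \<le> 2"
  shows "dist_E U V \<le> ereal (2 * arcsin (norm (V - U) / 2))"
proof -
  \<comment> \<open>Halving makes \<open>sum e B\<close> the squared half-chord, that is, the square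
    of the argument of \<open>arcsin\<close>.\<close>
  define D where "D b = (1/2) *\<^sub>R ((V - U) *v b)" for b
  define e where "e b = (norm (D b))\<^sup>2" for b
  obtain B where "finite B" "span B = (UNIV :: (real^'p) set)" "\<forall>b\<in>B. norm b = 1"
      and D_orth: "\<forall>b\<in>B. \<forall>c\<in>B. b \<noteq> c \<longrightarrow> b \<bullet> c = 0 \<and> D b \<bullet> D c = 0"
    using exists_basis_orthogonal_images[of "(*v) (V - U)" UNIV]
    by (auto simp: matrix_vector_mul_linear D_def)
  then have B: "orthonormal_basis B" by (auto simp: orthonormal_basis_def norm_eq_1)
  have fin: "finite B" and on: "\<And>b c. b \<in> B \<Longrightarrow> c \<in> B \<Longrightarrow> b \<bullet> c = (if b = c then 1 else 0)"
    using B by (auto simp: orthonormal_basis_def)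
  have Ui: "(U *v x) \<bullet> (U *v y) = x \<bullet> y" and Vi: "(V *v x) \<bullet> (V *v y) = x \<bullet> y" for x y
    using assms(2,3) by (auto simp: stiefel_iff_inner)
  have V_eq: "V *v b = U *v b + 2 *\<^sub>R D b" for b
    by (simp add: D_def matrix_vector_mult_diff_rdistrib)
  have DD: "D b \<bullet> D c = (if b = c then e b else 0)" if "b \<in> B" "c \<in> B" for b c
    using D_orth that by (simp add: e_def power2_norm_eq_inner)
  \<comment> \<open>Expand the inner product of \<open>U *v b + 2 *\<^sub>R D b\<close> and
    \<open>U *v c + 2 *\<^sub>R D c\<close>, using that \<open>U\<close> and \<open>V\<close> both
    preserve inner products.\<close>
  have UD: "(U *v b) \<bullet> D c + D b \<bullet> (U *v c) = - 2 * (D b \<bullet> D c)" for b c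
    using Vi[of b c] Ui[of b c]
    by (simp add: V_eq inner_add_left inner_add_right)
  have sum_e: "sum e B = (norm (V - U) / 2)\<^sup>2"
    by (simp add: norm_matrix_basis[OF B, of "V - U"] e_def D_def power_divide sum_divide_distrib)
  have sum_le1: "sum e B \<le> 1"
    using assms(4) power_mono[of "norm (V - U) / 2" 1 2] by (simp add: sum_e)
  have e0: "0 \<le> e b" for b by (simp add: e_def)
  have e_le1: "e b \<le> 1" if "b \<in> B" for b
    using member_le_sum[OF that, of e] fin e0 sum_le1 by force
  show ?thesis
  proof (cases "\<exists>b\<in>B. e b = 1")
    case True
    then obtain b0 where b0: "b0 \<in> B" "e b0 = 1" by blast
    \<comment> \<open>The bound on the total leaves nothing for the other columns, so they are
      fixed.\<close>
    have "sum e (B - {b0}) \<le> 0"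
      using sum_le1 b0 fin by (simp add: sum_diff1)
    then have ez: "e b = 0" if "b \<in> B" "b \<noteq> b0" for b
      using that fin e0 sum_nonneg_eq_0_iff[of "B - {b0}" e] sum_nonneg[of "B - {b0}" e]
      by force
    then have V_other: "V *v b = U *v b" if "b \<in> B" "b \<noteq> b0" for b
      using that by (simp add: V_eq e_def)
    have V_b0: "V *v b0 = - (U *v b0)"
    proof -
      \<comment> \<open>The three contributions are 1, -2 (from \<open>UD\<close>) and 1.\<close>
      have "(norm (U *v b0 + D b0))\<^sup>2 = 0"
        using UD[of b0 b0] DD[OF b0(1) b0(1)] Ui[of b0 b0] on[OF b0(1) b0(1)] b0
        by (simp add: power2_norm_eq_inner inner_add_left inner_add_right inner_commute)
      then have "D b0 = - (U *v b0)" by (simp add: add_eq_0_iff2)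
      then show ?thesis by (simp add: V_eq scaleR_2)
    qed
    \<comment> \<open>The range of \<open>U\<close> has dimension at most
      \<open>p < 2p \<le> n\<close>, which leaves room for a unit normal \<open>w\<close>.\<close>
    have "dim (range ((*v) U)) \<le> CARD('p)"
      using dim_image_le[OF matrix_vector_mul_linear, of U UNIV] by simp
    also have "\<dots> < CARD('n)"
      using assms(1) zero_less_card_finite[where 'a='p] by linarith
    finally have "dim (range ((*v) U)) < DIM(real^'n)" by simp
    then obtain w' where w': "w' \<noteq> 0" "\<And>y. y \<in> span (range ((*v) U)) \<Longrightarrow> orthogonal w' y"
      by (rule orthogonal_to_subspace_exists) blast
    define w where "w = w' /\<^sub>R norm w'"
    have w: "w \<bullet> w = 1" "w \<bullet> (U *v x) = 0" "(U *v x) \<bullet> w = 0" for x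
    proof -
      have "w' \<bullet> (U *v x) = 0"
        using w'(2) span_base[of "U *v x" "range ((*v) U)"] by (auto simp: orthogonal_def)
      then show "w \<bullet> (U *v x) = 0" "(U *v x) \<bullet> w = 0"
        by (simp_all add: w_def inner_commute)
      show "w \<bullet> w = 1"
        using w'(1) by (simp only: flip: norm_eq_1) (simp add: w_def)
    qed
    \<comment> \<open>A half-turn at constant speed \<open>pi\<close> in the plane of
      \<open>U *v b0\<close> and \<open>w\<close>.\<close>
    define g where "g b t = (if b = b0 then cos (pi * t) *\<^sub>R (U *v b) + sin (pi * t) *\<^sub>R w
      else U *v b)" for b t
    define g' where "g' b t = (if b = b0 then
      (- pi * sin (pi * t)) *\<^sub>R (U *v b) + (pi * cos (pi * t)) *\<^sub>R w else 0)" for b t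
    have "dist_E U V \<le> ereal (integral {0..1} (\<lambda>t. sqrt (\<Sum>b\<in>B. (norm (g' b t))\<^sup>2)))"
    proof (rule dist_E_le_columnwise[OF B, of g])
      show "(g b has_vector_derivative g' b t) (at t within {0..1})" for b t
        unfolding g_def g'_def
        by (cases "b = b0") (auto intro!: derivative_eq_intros simp: algebra_simps)
      show "continuous_on {0..1} (g' b)" for b
        unfolding g'_def by (cases "b = b0") (auto intro!: continuous_intros)
      show "g b t \<bullet> g c t = b \<bullet> c" if "b \<in> B" "c \<in> B" for b c t
      proof -
        have "cos (pi * t) * cos (pi * t) + sin (pi * t) * sin (pi * t) = 1"
          by (simp flip: power2_eq_square)
        then show ?thesis
          using that by (auto simp: g_def inner_add_left inner_add_right w Ui on b0)
      qed
      show "g b 0 = U *v b" for b by (simp add: g_def)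
      show "g b 1 = V *v b" if "b \<in> B" for b
        using that V_other V_b0 by (simp add: g_def)
    qed
    also have "integral {0..1} (\<lambda>t. sqrt (\<Sum>b\<in>B. (norm (g' b t))\<^sup>2)) = pi"
    proof -
      have "(\<Sum>b\<in>B. (norm (g' b t))\<^sup>2) = pi\<^sup>2" for t
      proof -
        have "(norm (g' b0 t))\<^sup>2 = (pi * cos (pi * t))\<^sup>2 + (pi * sin (pi * t))\<^sup>2"
          unfolding power2_norm_eq_inner
          by (simp add: g'_def inner_add_left inner_add_right inner_diff_left inner_diff_right
              w Ui on b0 power2_eq_square)
        also have "\<dots> = pi\<^sup>2"
          by (simp add: power_mult_distrib flip: distrib_left)
        finally have "(norm (g' b0 t))\<^sup>2 = pi\<^sup>2" .
        then have "(norm (g' b t))\<^sup>2 = (if b = b0 then pi\<^sup>2 else 0)" for b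
          by (simp add: g'_def)
        then show ?thesis using fin b0 by simp
      qed
      then show ?thesis by simp
    qed
    also have "pi = 2 * arcsin (norm (V - U) / 2)"
    proof -
      \<comment> \<open>Here the chord is exactly 2, so the bound equals the length
        \<open>pi\<close>.\<close>
      have "1 \<le> (norm (V - U) / 2)\<^sup>2"
        using member_le_sum[OF b0(1), of e] fin e0 b0 by (simp flip: sum_e)
      then have "norm (V - U) / 2 = 1"
        using assms(4) power2_le_imp_le[of 1 "norm (V - U) / 2"] by simp
      then show ?thesis by simp
    qed
    finally show ?thesis .
  next
    case False
    then have e: "0 \<le> e b \<and> e b < 1" if "b \<in> B" for b
      using that e0 e_le1 by (metis less_eq_real_def)
    define P where "P \<tau> b = 1 - (1 - \<tau>\<^sup>2) * e b" for \<tau> b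
    have P: "P \<tau> b > 0" if "b \<in> B" for \<tau> b
    proof -
      have "P \<tau> b = (1 - e b) + \<tau>\<^sup>2 * e b" by (simp add: P_def algebra_simps)
      moreover have "\<tau>\<^sup>2 * e b \<ge> 0" using e[OF that] by simp
      ultimately show ?thesis using e[OF that] by linarith
    qed
    \<comment> \<open>\<open>C b\<close> is the image of \<open>b\<close> under the midpoint of
      \<open>U\<close> and \<open>V\<close>, so \<open>\<tau> = -1\<close> and
      \<open>\<tau> = 1\<close> give \<open>U *v b\<close> and \<open>V *v b\<close>.\<close>
    define C where "C b = U *v b + D b" for b
    define h where "h b \<tau> = (1 / sqrt (P \<tau> b)) *\<^sub>R (C b + \<tau> *\<^sub>R D b)" for b \<tau>
    define h' where "h' b \<tau> = (1 / sqrt (P \<tau> b) ^ 3) *\<^sub>R ((1 - e b) *\<^sub>R D b - (\<tau> * e b) *\<^sub>R C b)"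
      for b \<tau>
    \<comment> \<open>Since \<open>C b + \<tau> *\<^sub>R D b = U *v b + (1 + \<tau>) *\<^sub>R D
      b\<close>, inserting \<open>UD\<close> gives the coefficient
      \<open>(1 + \<tau>)\<^sup>2 - 2 * (1 + \<tau>) = \<tau>\<^sup>2 - 1\<close>.\<close>
    have gram: "(C b + \<tau> *\<^sub>R D b) \<bullet> (C c + \<tau> *\<^sub>R D c) = b \<bullet> c - (1 - \<tau>\<^sup>2) * (D b \<bullet> D c)"
      for b c \<tau>
    proof -
      have "(C b + \<tau> *\<^sub>R D b) \<bullet> (C c + \<tau> *\<^sub>R D c)
          = b \<bullet> c + (1 + \<tau>) * ((U *v b) \<bullet> D c + D b \<bullet> (U *v c)) + (1 + \<tau>)\<^sup>2 * (D b \<bullet> D c)"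
        by (simp add: C_def inner_add_left inner_add_right Ui power2_eq_square algebra_simps)
      then show ?thesis by (simp only: UD) (simp add: power2_eq_square algebra_simps)
    qed
    have speed: "(norm (h' b \<tau>))\<^sup>2 = e b * (1 - e b) / (P \<tau> b)\<^sup>2" if b: "b \<in> B" for b \<tau>
    proof -
      have D2: "D b \<bullet> D b = e b" using DD b by simp
      \<comment> \<open>Evaluating \<open>gram\<close> at 0 and 1 yields the norm of
        \<open>C b\<close> and its orthogonality to \<open>D b\<close>, so the speed follows from
        Pythagoras.\<close>
      have C2: "C b \<bullet> C b = 1 - e b" using gram[of b 0 b] on b D2 by simp
      have CD: "C b \<bullet> D b = 0" "D b \<bullet> C b = 0"
        using gram[of b 1 b] on b D2 C2 by (simp_all add: inner_add_left inner_add_right inner_commute)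
      have "(norm ((1 - e b) *\<^sub>R D b - (\<tau> * e b) *\<^sub>R C b))\<^sup>2
          = (1 - e b)\<^sup>2 * e b + \<tau>\<^sup>2 * (e b)\<^sup>2 * (1 - e b)"
        unfolding power2_norm_eq_inner
        by (simp add: inner_diff_left inner_diff_right D2 C2 CD power2_eq_square algebra_simps)
      also have "\<dots> = e b * (1 - e b) * P \<tau> b"
        by (simp add: P_def power2_eq_square algebra_simps)
      finally have "(norm (h' b \<tau>))\<^sup>2 = e b * (1 - e b) * P \<tau> b / (sqrt (P \<tau> b) ^ 3)\<^sup>2"
        by (simp add: h'_def power_mult_distrib power_divide)
      also have "(sqrt (P \<tau> b) ^ 3)\<^sup>2 = P \<tau> b ^ 3"
        using P[OF b, of \<tau>] by (metis less_imp_le power_commutes power_mult mult.commute real_sqrt_pow2)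
      finally show ?thesis
        using P[OF b, of \<tau>] by (simp add: power3_eq_cube power2_eq_square)
    qed
    have "dist_E U V \<le>
      ereal (integral {0..1} (\<lambda>t. sqrt (\<Sum>b\<in>B. (norm (2 *\<^sub>R h' b (2 * t - 1)))\<^sup>2)))"
    proof (rule dist_E_le_columnwise[OF B, of "\<lambda>b t. h b (2 * t - 1)"])
      show "((\<lambda>t. h b (2 * t - 1)) has_vector_derivative 2 *\<^sub>R h' b (2 * t - 1))
          (at t within {0..1})" if "b \<in> B" for b t
      proof -
        have "((\<lambda>t. 2 * t - 1) has_vector_derivative 2) (at t)"
          by (auto intro!: derivative_eq_intros)
        moreover have "(h b has_vector_derivative h' b (2 * t - 1)) (at (2 * t - 1))"
          using has_vector_derivative_normalized_segment[of "2 * t - 1" "e b"] P[OF that, of "2 * t - 1"]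
          unfolding h_def h'_def P_def by blast
        ultimately have "(h b \<circ> (\<lambda>t. 2 * t - 1) has_vector_derivative 2 *\<^sub>R h' b (2 * t - 1)) (at t)"
          by (rule vector_diff_chain_at)
        then show ?thesis by (simp add: o_def has_vector_derivative_at_within)
      qed
      show "continuous_on {0..1} (\<lambda>t. 2 *\<^sub>R h' b (2 * t - 1))" if "b \<in> B" for b
        using P[OF that] unfolding h'_def P_def
        by (intro continuous_intros) (auto simp: less_imp_neq[symmetric])
      show "h b (2 * t - 1) \<bullet> h c (2 * t - 1) = b \<bullet> c" if bc: "b \<in> B" "c \<in> B" for b c t
      proof -
        let ?\<tau> = "2 * t - 1"
        have "h b ?\<tau> \<bullet> h c ?\<tau> = (b \<bullet> c - (1 - ?\<tau>\<^sup>2) * (D b \<bullet> D c)) / (sqrt (P ?\<tau> b) * sqrt (P ?\<tau> c))"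
          by (simp only: h_def inner_scaleR_left inner_scaleR_right gram) simp
        also have "b \<bullet> c - (1 - ?\<tau>\<^sup>2) * (D b \<bullet> D c) = (if b = c then P ?\<tau> b else 0)"
          unfolding DD[OF bc] on[OF bc] P_def by auto
        also have "\<dots> / (sqrt (P ?\<tau> b) * sqrt (P ?\<tau> c)) = b \<bullet> c"
          using P[OF bc(1), of ?\<tau>] by (auto simp: on[OF bc] simp flip: real_sqrt_mult)
        finally show ?thesis .
      qed
      show "h b (2 * 0 - 1) = U *v b" "h b (2 * 1 - 1) = V *v b" for b
        by (simp_all add: h_def P_def C_def V_eq scaleR_2)
    qed
    also have "integral {0..1} (\<lambda>t. sqrt (\<Sum>b\<in>B. (norm (2 *\<^sub>R h' b (2 * t - 1)))\<^sup>2))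
        = integral {0..1} (\<lambda>t. 2 * sqrt (\<Sum>b\<in>B. e b * (1 - e b) / (P (2 * t - 1) b)\<^sup>2))"
    proof -
      have "sqrt (\<Sum>b\<in>B. (norm (2 *\<^sub>R h' b \<tau>))\<^sup>2)
          = 2 * sqrt (\<Sum>b\<in>B. e b * (1 - e b) / (P \<tau> b)\<^sup>2)" for \<tau>
      proof -
        have "(\<Sum>b\<in>B. (norm (2 *\<^sub>R h' b \<tau>))\<^sup>2) = 4 * (\<Sum>b\<in>B. e b * (1 - e b) / (P \<tau> b)\<^sup>2)"
          by (simp add: power_mult_distrib speed sum_distrib_left)
        then show ?thesis by (simp add: real_sqrt_mult)
      qed
      then show ?thesis by simp
    qed
    also have "\<dots> \<le> 2 * arcsin (sqrt (sum e B))"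
      unfolding P_def by (rule integral_speed_le_arcsin[OF fin e sum_le1])
    also have "sqrt (sum e B) = norm (V - U) / 2"
      by (simp add: sum_e)
    finally show ?thesis by simp
  qed
qed

end
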